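(* Let $(G,H,\alpha,\tau)$ and $(H,J,\alpha',\tau')$ be Lie crossed modules, $\mathbf G$ the categorical Lie group associated with $(G,H,\alpha,\tau)$, $B$ a smooth manifold with open covering $\{U_i\}_{i\in\mathcal I}$, and $\{h_{ik},j_{ikm}\}$ a gerbal cocycle associated with this covering and $(H,J,\alpha',\tau')$. Let $i,k,m\in\mathcal I$ with $U_{ikm}=U_i\cap U_k\cap U_m\ne\emptyset$, and let $\theta_{ik},\theta_{km},\theta_{im}$ be the associated functors to $\mathbf G$ (defined in the context), restricted to $\mathbf U_{ikm}$. For $u\in U_{ikm}$ set $$\mathbb T_{ikm}(u)=\bigl(h_{ikm}(u),\,g_{ik}(u)g_{km}(u)\bigr)\in H\rtimes_\alpha G=\mathrm{Mor}(\mathbf G).$$ Then $\mathbb T_{ikm}$ is a natural transformation $$\mathbb T_{ikm}:\theta_{ik}\theta_{km}\Rightarrow\theta_{im}$$ of functors $\mathbf U_{ikm}\to\mathbf G$.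
   Context: A crossed module $(G,H,\alpha,\tau)$ consists of groups $G,H$ and homomorphisms $\tau:H\to G$, $\alpha:G\to\mathrm{Aut}(H)$ with $\tau(\alpha_g(h))=g\tau(h)g^{-1}$ and $\alpha_{\tau(h)}(h')=hh'h^{-1}$. It is a Lie crossed module if $G,H$ are Lie groups and $\tau$ and $(h,g)\mapsto\alpha_g(h)$ are smooth. The associated categorical group $\mathbf G$ has $\mathrm{Obj}(\mathbf G)=G$, $\mathrm{Mor}(\mathbf G)=H\rtimes_\alpha G$ with product $(h_2,g_2)(h_1,g_1)=(h_2\alpha_{g_2}(h_1),g_2g_1)$, source $s(h,g)=g$, target $t(h,g)=\tau(h)g$, and composition $(h_2,g_2)\circ(h_1,g_1)=(h_2h_1,g_1)$ when $g_2=\tau(h_1)g_1$. The group product is a functor $\mathbf G\times\mathbf G\to\mathbf G$. Path categories: for a nonempty finite intersection $U$ of sets of the covering, $\mathbf U$ is the category whose objects are the points of $U$ and whose morphisms are smooth paths $\gamma:[a,b]\to B$ ($a\le b$) lying in $U$ and constant near $a$ and near $b$, two paths being identified if they differ by a translation of the parameter interval. The source is $\gamma_0=\gamma(a)$, the target is $\gamma_1=\gamma(b)$, and composition is concatenation; degenerate paths ($a=b$) are identities. $\mathbf U_{ik}$ and $\mathbf U_{ikm}$ are the categories for $U_{ik}=U_i\cap U_k$ and $U_{ikm}=U_i\cap U_k\cap U_m$. Gerbal cocycle: smooth maps $h_{ik}:U_{ik}\to H$ and $j_{ikm}:U_{ikm}\to J$ (for all nonempty intersections) with $h_{im}(u)=\tau'(j_{ikm}(u))\,h_{ik}(u)\,h_{km}(u)$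 for all $u\in U_{ikm}$. Notation: $g_{ik}=\tau(h_{ik}):U_{ik}\to G$ and $h_{ikm}=\tau'(j_{ikm}):U_{ikm}\to H$. The functor $\theta_{ik}:\mathbf U_{ik}\to\mathbf G$ is given on objects by $\theta_{ik}(u)=g_{ik}(u)$ and on morphisms by $\theta_{ik}(\gamma)=(h_{ik}(\gamma),g_{ik}(\gamma_0))$, where $h_{ik}(\gamma)=h_{ik}(\gamma_1)h_{ik}(\gamma_0)^{-1}$. The product $\theta_{ik}\theta_{km}$ is the functor on $\mathbf U_{ikm}$ given by the pointwise product, on objects and on morphisms, in $\mathbf G$. *)

theory Defs
  imports "HOL-Analysis.Analysis" "HOL-Algebra.Bij"
begin

section \<open>Smooth maps between subsets of Euclidean spaces\<close>

text \<open>\<open>Ck_on k W f\<close>: \<open>f\<close> is of class \<open>C^k\<close> on \<open>W\<close>. It is only meant for open \<open>W\<close>.\<close>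

primrec Ck_on ::
  "nat \<Rightarrow> 'e::euclidean_space set \<Rightarrow> ('e \<Rightarrow> 'f::euclidean_space) \<Rightarrow> bool" where
  "Ck_on 0 W f \<longleftrightarrow> continuous_on W f"
| "Ck_on (Suc k) W f \<longleftrightarrow>
     (\<forall>x\<in>W. f differentiable (at x)) \<and>
     (\<forall>v. Ck_on k W (\<lambda>x. frechet_derivative f (at x) v))"

text \<open>Smoothness on an arbitrary subset \<open>A\<close> means having smooth local extensions to open sets
  of the ambient space. For \<open>A\<close> open, or relatively open in a linear subspace, this is ordinary
  smoothness; for \<open>A\<close> a compact interval it is smoothness with one-sided derivatives at the
  end points.\<close>

definition smooth_on ::
  "'e::euclidean_space set \<Rightarrow> ('e \<Rightarrow> 'f::euclidean_space) \<Rightarrow> bool" where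
  "smooth_on A f \<longleftrightarrow>
     (\<forall>x\<in>A. \<exists>W g. open W \<and> x \<in> W \<and> (\<forall>k. Ck_on k W g) \<and> (\<forall>y\<in>A \<inter> W. g y = f y))"


section \<open>Smooth manifolds\<close>

text \<open>A chart is a pair \<open>(U, \<phi>)\<close> of its domain and its coordinate map; only the values of \<open>\<phi>\<close> on
  \<open>U\<close> matter. The atlas is not assumed to be maximal.\<close>

record ('a, 'e) manifold =
  Top :: "'a topology"
  Atlas :: "('a set \<times> ('a \<Rightarrow> 'e)) set"

text \<open>Charts take values in a fixed linear subspace \<open>V\<close> of the Euclidean space \<open>'e\<close>, so that the
  dimension of the manifold is \<open>dim V\<close>. Since \<open>DIM('e)\<close> is never zero, charts onto open subsets
  of \<open>'e\<close> itself would exclude manifolds of dimension \<open>0\<close> (discrete Lie groups in particular).\<close>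

definition smooth_manifold :: "('a, 'e::euclidean_space) manifold \<Rightarrow> bool" where
  "smooth_manifold M \<longleftrightarrow>
     Hausdorff_space (Top M) \<and> second_countable (Top M) \<and>
     (\<Union>(U, \<phi>)\<in>Atlas M. U) = topspace (Top M) \<and>
     (\<exists>V. subspace V \<and>
        (\<forall>(U, \<phi>)\<in>Atlas M.
           openin (Top M) U \<and>
           openin (top_of_set V) (\<phi> ` U) \<and>
           homeomorphic_map (subtopology (Top M) U) (top_of_set (\<phi> ` U)) \<phi>)) \<and>
     (\<forall>(U, \<phi>)\<in>Atlas M. \<forall>(U', \<phi>')\<in>Atlas M.
        smooth_on (\<phi> ` (U \<inter> U')) (\<phi>' \<circ> inv_into U \<phi>))"

text \<open>Smoothness of \<open>f\<close> on a subset \<open>A\<close> of \<open>M\<close>. This is used for open \<open>A\<close> and for compact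
  intervals \<open>A\<close> in the real line.\<close>

definition smooth_map_on ::
  "('a, 'e::euclidean_space) manifold \<Rightarrow> 'a set \<Rightarrow> ('b, 'f::euclidean_space) manifold
    \<Rightarrow> ('a \<Rightarrow> 'b) \<Rightarrow> bool" where
  "smooth_map_on M A N f \<longleftrightarrow>
     A \<subseteq> topspace (Top M) \<and>
     continuous_map (subtopology (Top M) A) (Top N) f \<and>
     (\<forall>(U, \<phi>)\<in>Atlas M. \<forall>(V, \<psi>)\<in>Atlas N.
        smooth_on (\<phi> ` (A \<inter> U \<inter> f -` V)) (\<psi> \<circ> f \<circ> inv_into U \<phi>))"

abbreviation smooth_map ::
  "('a, 'e::euclidean_space) manifold \<Rightarrow> ('b, 'f::euclidean_space) manifold
    \<Rightarrow> ('a \<Rightarrow> 'b) \<Rightarrow> bool" where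
  "smooth_map M N f \<equiv> smooth_map_on M (topspace (Top M)) N f"

definition prod_manifold ::
  "('a, 'e) manifold \<Rightarrow> ('b, 'f) manifold \<Rightarrow> ('a \<times> 'b, 'e \<times> 'f) manifold" where
  "prod_manifold M N =
     \<lparr>Top = prod_topology (Top M) (Top N),
      Atlas = {(U \<times> V, map_prod \<phi> \<psi>) | U \<phi> V \<psi>. (U, \<phi>) \<in> Atlas M \<and> (V, \<psi>) \<in> Atlas N}\<rparr>"

definition real_line :: "(real, real) manifold" where
  "real_line = \<lparr>Top = euclidean, Atlas = {(UNIV, id)}\<rparr>"


section \<open>Lie groups and Lie crossed modules\<close>

record ('a, 'e) lie_group = "'a monoid" +
  mfd :: "('a, 'e) manifold"

locale lie_group = group G for G :: "('a, 'e::euclidean_space) lie_group" (structure) +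
  assumes smooth_manifold_mfd: "smooth_manifold (mfd G)"
    and topspace_mfd: "topspace (Top (mfd G)) = carrier G"
    and smooth_mult: "smooth_map (prod_manifold (mfd G) (mfd G)) (mfd G) (\<lambda>(x, y). x \<otimes> y)"
    and smooth_inv: "smooth_map (mfd G) (mfd G) (\<lambda>x. inv x)"

locale crossed_module = G: group G + H: group H
  for G :: "('g, 'x) monoid_scheme" and H :: "('h, 'y) monoid_scheme"
    and \<alpha> :: "'g \<Rightarrow> 'h \<Rightarrow> 'h" and \<tau> :: "'h \<Rightarrow> 'g" +
  assumes tau_hom: "\<tau> \<in> hom H G"
    and alpha_hom: "\<alpha> \<in> hom G (AutoGroup H)"
    and tau_alpha: "\<And>g h. \<lbrakk>g \<in> carrier G; h \<in> carrier H\<rbrakk> \<Longrightarrow>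
          \<tau> (\<alpha> g h) = g \<otimes>\<^bsub>G\<^esub> \<tau> h \<otimes>\<^bsub>G\<^esub> inv\<^bsub>G\<^esub> g"
    and alpha_tau: "\<And>h h'. \<lbrakk>h \<in> carrier H; h' \<in> carrier H\<rbrakk> \<Longrightarrow>
          \<alpha> (\<tau> h) h' = h \<otimes>\<^bsub>H\<^esub> h' \<otimes>\<^bsub>H\<^esub> inv\<^bsub>H\<^esub> h"

locale lie_crossed_module = G: lie_group G + H: lie_group H + crossed_module G H \<alpha> \<tau>
  for G :: "('g, 'eg::euclidean_space) lie_group"
    and H :: "('h, 'eh::euclidean_space) lie_group"
    and \<alpha> \<tau> +
  assumes smooth_tau: "smooth_map (mfd H) (mfd G) \<tau>"
    and smooth_alpha: "smooth_map (prod_manifold (mfd H) (mfd G)) (mfd H) (\<lambda>(h, g). \<alpha> g h)"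


section \<open>Categories, functors and natural transformations\<close>

text \<open>\<open>Comp C g f\<close> is the composite \<open>g \<circ> f\<close>, defined when \<open>Cod C f = Dom C g\<close>.\<close>

record ('o, 'm) cat =
  Obj :: "'o set"
  Mor :: "'m set"
  Dom :: "'m \<Rightarrow> 'o"
  Cod :: "'m \<Rightarrow> 'o"
  Id :: "'o \<Rightarrow> 'm"
  Comp :: "'m \<Rightarrow> 'm \<Rightarrow> 'm"

locale category =
  fixes C :: "('o, 'm) cat"
  assumes Dom_Obj: "f \<in> Mor C \<Longrightarrow> Dom C f \<in> Obj C"
    and Cod_Obj: "f \<in> Mor C \<Longrightarrow> Cod C f \<in> Obj C"
    and Id_Mor: "x \<in> Obj C \<Longrightarrow> Id C x \<in> Mor C"
    and Dom_Id: "x \<in> Obj C \<Longrightarrow> Dom C (Id C x) = x"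
    and Cod_Id: "x \<in> Obj C \<Longrightarrow> Cod C (Id C x) = x"
    and Comp_Mor: "\<lbrakk>f \<in> Mor C; g \<in> Mor C; Cod C f = Dom C g\<rbrakk> \<Longrightarrow> Comp C g f \<in> Mor C"
    and Dom_Comp: "\<lbrakk>f \<in> Mor C; g \<in> Mor C; Cod C f = Dom C g\<rbrakk> \<Longrightarrow> Dom C (Comp C g f) = Dom C f"
    and Cod_Comp: "\<lbrakk>f \<in> Mor C; g \<in> Mor C; Cod C f = Dom C g\<rbrakk> \<Longrightarrow> Cod C (Comp C g f) = Cod C g"
    and Comp_Id_right: "f \<in> Mor C \<Longrightarrow> Comp C f (Id C (Dom C f)) = f"
    and Comp_Id_left: "f \<in> Mor C \<Longrightarrow> Comp C (Id C (Cod C f)) f = f"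
    and Comp_assoc: "\<lbrakk>f \<in> Mor C; g \<in> Mor C; k \<in> Mor C; Cod C f = Dom C g; Cod C g = Dom C k\<rbrakk> \<Longrightarrow>
          Comp C k (Comp C g f) = Comp C (Comp C k g) f"

text \<open>Only the values on the objects and morphisms of the source category matter, so the same
  record also represents the restriction of a functor to a subcategory.\<close>

record ('o, 'm, 'p, 'n) fctr =
  onObj :: "'o \<Rightarrow> 'p"
  onMor :: "'m \<Rightarrow> 'n"

locale is_functor = C: category C + D: category D
  for C :: "('o, 'm) cat" and D :: "('p, 'n) cat" and F :: "('o, 'm, 'p, 'n) fctr" +
  assumes onObj_Obj: "x \<in> Obj C \<Longrightarrow> onObj F x \<in> Obj D"
    and onMor_Mor: "f \<in> Mor C \<Longrightarrow> onMor F f \<in> Mor D"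
    and onMor_Dom: "f \<in> Mor C \<Longrightarrow> Dom D (onMor F f) = onObj F (Dom C f)"
    and onMor_Cod: "f \<in> Mor C \<Longrightarrow> Cod D (onMor F f) = onObj F (Cod C f)"
    and onMor_Id: "x \<in> Obj C \<Longrightarrow> onMor F (Id C x) = Id D (onObj F x)"
    and onMor_Comp: "\<lbrakk>f \<in> Mor C; g \<in> Mor C; Cod C f = Dom C g\<rbrakk> \<Longrightarrow>
          onMor F (Comp C g f) = Comp D (onMor F g) (onMor F f)"

locale natural_transformation = F: is_functor C D F + F': is_functor C D F'
  for C :: "('o, 'm) cat" and D :: "('p, 'n) cat"
    and F F' :: "('o, 'm, 'p, 'n) fctr" and T :: "'o \<Rightarrow> 'n" +
  assumes component_Mor: "x \<in> Obj C \<Longrightarrow> T x \<in> Mor D"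
    and component_Dom: "x \<in> Obj C \<Longrightarrow> Dom D (T x) = onObj F x"
    and component_Cod: "x \<in> Obj C \<Longrightarrow> Cod D (T x) = onObj F' x"
    and naturality: "f \<in> Mor C \<Longrightarrow>
          Comp D (T (Cod C f)) (onMor F f) = Comp D (onMor F' f) (T (Dom C f))"


section \<open>The categorical group of a crossed module\<close>

definition semidirect ::
  "('h, 'y) monoid_scheme \<Rightarrow> ('g, 'x) monoid_scheme \<Rightarrow> ('g \<Rightarrow> 'h \<Rightarrow> 'h) \<Rightarrow> ('h \<times> 'g) monoid" where
  "semidirect H G \<alpha> =
     \<lparr>carrier = carrier H \<times> carrier G,
      mult = (\<lambda>(h2, g2) (h1, g1). (h2 \<otimes>\<^bsub>H\<^esub> \<alpha> g2 h1, g2 \<otimes>\<^bsub>G\<^esub> g1)),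
      one = (\<one>\<^bsub>H\<^esub>, \<one>\<^bsub>G\<^esub>)\<rparr>"

definition categorical_group ::
  "('g, 'x) monoid_scheme \<Rightarrow> ('h, 'y) monoid_scheme \<Rightarrow> ('g \<Rightarrow> 'h \<Rightarrow> 'h) \<Rightarrow> ('h \<Rightarrow> 'g)
    \<Rightarrow> ('g, 'h \<times> 'g) cat" where
  "categorical_group G H \<alpha> \<tau> =
     \<lparr>Obj = carrier G,
      Mor = carrier (semidirect H G \<alpha>),
      Dom = (\<lambda>(h, g). g),
      Cod = (\<lambda>(h, g). \<tau> h \<otimes>\<^bsub>G\<^esub> g),
      Id = (\<lambda>g. (\<one>\<^bsub>H\<^esub>, g)),
      Comp = (\<lambda>(h2, g2) (h1, g1). (h2 \<otimes>\<^bsub>H\<^esub> h1, g1))\<rparr>"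

text \<open>Pointwise product of functors into the categorical group.\<close>

definition fctr_prod ::
  "('g, 'x) monoid_scheme \<Rightarrow> ('h, 'y) monoid_scheme \<Rightarrow> ('g \<Rightarrow> 'h \<Rightarrow> 'h)
    \<Rightarrow> ('o, 'm, 'g, 'h \<times> 'g) fctr \<Rightarrow> ('o, 'm, 'g, 'h \<times> 'g) fctr \<Rightarrow> ('o, 'm, 'g, 'h \<times> 'g) fctr" where
  "fctr_prod G H \<alpha> F F' =
     \<lparr>onObj = (\<lambda>x. onObj F x \<otimes>\<^bsub>G\<^esub> onObj F' x),
      onMor = (\<lambda>f. onMor F f \<otimes>\<^bsub>semidirect H G \<alpha>\<^esub> onMor F' f)\<rparr>"


section \<open>Path categories\<close>

text \<open>A triple \<open>(a, b, \<gamma>)\<close> stands for the path \<open>\<gamma> : [a,b] \<rightarrow> B\<close>.\<close>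

type_synonym 'b path = "real \<times> real \<times> (real \<Rightarrow> 'b)"

definition paths :: "('b, 'e::euclidean_space) manifold \<Rightarrow> 'b set \<Rightarrow> 'b path set" where
  "paths B U = {(a, b, \<gamma>). a \<le> b \<and>
     smooth_map_on real_line {a..b} B \<gamma> \<and> \<gamma> ` {a..b} \<subseteq> U \<and>
     (\<exists>\<epsilon>>0. (\<forall>t\<in>{a..b}. t < a + \<epsilon> \<longrightarrow> \<gamma> t = \<gamma> a) \<and>
            (\<forall>t\<in>{a..b}. b - \<epsilon> < t \<longrightarrow> \<gamma> t = \<gamma> b))}"

text \<open>Translation of the parameter interval. The relation also discards the irrelevant values of
  \<open>\<gamma>\<close> outside \<open>[a,b]\<close>.\<close>

definition translation_rel ::
  "('b, 'e::euclidean_space) manifold \<Rightarrow> 'b set \<Rightarrow> 'b path rel" where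
  "translation_rel B U = {((a, b, \<gamma>), (a', b', \<gamma>')).
     (a, b, \<gamma>) \<in> paths B U \<and> (a', b', \<gamma>') \<in> paths B U \<and>
     (\<exists>c. a' = a + c \<and> b' = b + c \<and> (\<forall>t\<in>{a..b}. \<gamma>' (t + c) = \<gamma> t))}"

fun path_start :: "'b path \<Rightarrow> 'b" where
  "path_start (a, b, \<gamma>) = \<gamma> a"

fun path_end :: "'b path \<Rightarrow> 'b" where
  "path_end (a, b, \<gamma>) = \<gamma> b"

text \<open>\<open>concat_path q p\<close> runs first through \<open>p\<close>, then through \<open>q\<close> translated so as to start at the
  end of the parameter interval of \<open>p\<close>.\<close>

fun concat_path :: "'b path \<Rightarrow> 'b path \<Rightarrow> 'b path" where
  "concat_path (c, d, \<delta>) (a, b, \<gamma>) =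
     (a, b + (d - c), \<lambda>t. if t \<le> b then \<gamma> t else \<delta> (t - b + c))"

text \<open>Source, target and composition of equivalence classes are obtained from arbitrary
  representatives; source and target do not depend on \<open>U\<close>.\<close>

definition class_start :: "'b path set \<Rightarrow> 'b" where
  "class_start X = the_elem (path_start ` X)"

definition class_end :: "'b path set \<Rightarrow> 'b" where
  "class_end X = the_elem (path_end ` X)"

definition path_category ::
  "('b, 'e::euclidean_space) manifold \<Rightarrow> 'b set \<Rightarrow> ('b, 'b path set) cat" where
  "path_category B U =
     \<lparr>Obj = U,
      Mor = paths B U // translation_rel B U,
      Dom = class_start,
      Cod = class_end,
      Id = (\<lambda>u. translation_rel B U `` {(0, 0, \<lambda>_. u)}),
      Comp = (\<lambda>Y X. \<Union>q\<in>Y. \<Union>p\<in>X. translation_rel B U `` {concat_path q p})\<rparr>"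


section \<open>Gerbal cocycles and the associated functors\<close>

locale gerbal_cocycle = lie_crossed_module H J \<alpha>' \<tau>'
  for B :: "('b, 'eb::euclidean_space) manifold" and I :: "'i set" and U :: "'i \<Rightarrow> 'b set"
    and H :: "('h, 'eh::euclidean_space) lie_group"
    and J :: "('j, 'ej::euclidean_space) lie_group"
    and \<alpha>' :: "'h \<Rightarrow> 'j \<Rightarrow> 'j" and \<tau>' :: "'j \<Rightarrow> 'h"
    and h :: "'i \<Rightarrow> 'i \<Rightarrow> 'b \<Rightarrow> 'h" and j :: "'i \<Rightarrow> 'i \<Rightarrow> 'i \<Rightarrow> 'b \<Rightarrow> 'j" +
  assumes smooth_base: "smooth_manifold B"
    and open_U: "\<And>i. i \<in> I \<Longrightarrow> openin (Top B) (U i)"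
    and cover_U: "(\<Union>i\<in>I. U i) = topspace (Top B)"
    and smooth_h: "\<And>i k. \<lbrakk>i \<in> I; k \<in> I; U i \<inter> U k \<noteq> {}\<rbrakk> \<Longrightarrow>
          smooth_map_on B (U i \<inter> U k) (mfd H) (h i k)"
    and smooth_j: "\<And>i k m. \<lbrakk>i \<in> I; k \<in> I; m \<in> I; U i \<inter> U k \<inter> U m \<noteq> {}\<rbrakk> \<Longrightarrow>
          smooth_map_on B (U i \<inter> U k \<inter> U m) (mfd J) (j i k m)"
    and cocycle: "\<And>i k m u. \<lbrakk>i \<in> I; k \<in> I; m \<in> I; u \<in> U i \<inter> U k \<inter> U m\<rbrakk> \<Longrightarrow>
          h i m u = \<tau>' (j i k m u) \<otimes>\<^bsub>H\<^esub> h i k u \<otimes>\<^bsub>H\<^esub> h k m u"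

text \<open>For \<open>h = h_ik\<close> this is the functor \<open>\<theta>_ik\<close>. A translation class of paths in a smaller open
  set is also a class of paths in the larger one, so the restriction of \<open>\<theta>_ik\<close> is literally given
  by the same formula.\<close>

definition theta ::
  "('h, 'y) monoid_scheme \<Rightarrow> ('h \<Rightarrow> 'g) \<Rightarrow> ('b \<Rightarrow> 'h) \<Rightarrow> ('b, 'b path set, 'g, 'h \<times> 'g) fctr" where
  "theta H \<tau> h =
     \<lparr>onObj = (\<lambda>u. \<tau> (h u)),
      onMor = (\<lambda>\<gamma>. (h (class_end \<gamma>) \<otimes>\<^bsub>H\<^esub> inv\<^bsub>H\<^esub> h (class_start \<gamma>), \<tau> (h (class_start \<gamma>))))\<rparr>"

end

theory Submission
  imports Defs
begin

text \<open>By the Peiffer identity \<open>\<alpha>\<^bsub>\<tau>(h)\<^esub>(h') = h h' h\<inverse>\<close>, the pointwise product of the functors given by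
  \<open>h\<^sub>i\<^sub>k\<close> and \<open>h\<^sub>k\<^sub>m\<close> is the functor given by the pointwise product \<open>h\<^sub>i\<^sub>k h\<^sub>k\<^sub>m\<close>. Naturality and the
  source-target conditions then amount to the cocycle identity \<open>h\<^sub>i\<^sub>m = \<tau>'(j\<^sub>i\<^sub>k\<^sub>m) (h\<^sub>i\<^sub>k h\<^sub>k\<^sub>m)\<close>.
  The analytic point is that paths concatenate to smooth paths: near the junction the
  concatenation is constant.\<close>

section \<open>Smoothness under restriction and translation\<close>

lemma Ck_on_subset: "Ck_on k W f \<Longrightarrow> W' \<subseteq> W \<Longrightarrow> Ck_on k W' f"
proof (induction k arbitrary: f)
  case 0
  then show ?case by (auto intro: continuous_on_subset)
next
  case (Suc k)
  then show ?case by auto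
qed

lemma Ck_on_const: "Ck_on k W (\<lambda>_. c)"
  by (induction k arbitrary: c) simp_all

text \<open>The chain rule with the translation by \<open>s\<close>, applied in both directions. The
  equivalence says that both sides admit exactly the same derivatives, which is what a comparison of
  \<open>frechet_derivative\<close>, defined by choice, calls for.\<close>

lemma has_derivative_at_shift:
  fixes f :: "'a::real_normed_vector \<Rightarrow> 'b::real_normed_vector"
  shows "((\<lambda>x. f (x + s)) has_derivative f') (at x) \<longleftrightarrow> (f has_derivative f') (at (x + s))"
proof
  assume "(f has_derivative f') (at (x + s))"
  moreover have "((\<lambda>x. x + s) has_derivative (\<lambda>x. x)) (at x)"
    by (auto intro!: derivative_eq_intros)
  ultimately show "((\<lambda>x. f (x + s)) has_derivative f') (at x)"
    using has_derivative_compose by fastforce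
next
  assume "((\<lambda>x. f (x + s)) has_derivative f') (at x)"
  moreover have "((\<lambda>x. x - s) has_derivative (\<lambda>x. x)) (at (x + s))"
    by (auto intro!: derivative_eq_intros)
  ultimately show "(f has_derivative f') (at (x + s))"
    using has_derivative_compose[of "\<lambda>x. x - s" "\<lambda>x. x" "x + s" UNIV "\<lambda>x. f (x + s)" f'] by simp
qed

text \<open>The directional derivative of a translate is the translate of the directional
  derivative, so the induction on \<open>k\<close> passes from \<open>f\<close> to its derivatives,
  with \<open>f\<close> kept arbitrary.\<close>

lemma Ck_on_shift: "Ck_on k W f \<Longrightarrow> Ck_on k {x. x + s \<in> W} (\<lambda>x. f (x + s))"
proof (induction k arbitrary: f)
  case 0
  then show ?case
    by (auto intro!: continuous_on_compose2[of W f] continuous_intros)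
next
  case (Suc k)
  \<comment> \<open>The predicates under the two choice operators coincide, so the equation holds at
    every \<open>x\<close>, also where \<open>f\<close> is not differentiable.\<close>
  have "frechet_derivative (\<lambda>x. f (x + s)) (at x) = frechet_derivative f (at (x + s))" for x
    by (simp add: frechet_derivative_def has_derivative_at_shift)
  moreover have "Ck_on k {x. x + s \<in> W} (\<lambda>x. frechet_derivative f (at (x + s)) v)" for v
    using Suc.prems by (intro Suc.IH) simp
  ultimately show ?case
    using Suc.prems by (simp add: differentiable_def has_derivative_at_shift)
qed

lemma smooth_on_const: "smooth_on A (\<lambda>_. c)"
  unfolding smooth_on_def using open_UNIV Ck_on_const by blast

section \<open>Concatenation of paths\<close>

text \<open>The only chart of \<open>real_line\<close> is the identity on the whole line, so the
  coordinate change on the source side disappears.\<close>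

lemma smooth_map_on_real_line_iff:
  "smooth_map_on real_line A B \<gamma> \<longleftrightarrow>
     continuous_map (top_of_set A) (Top B) \<gamma> \<and>
     (\<forall>(V, \<psi>)\<in>Atlas B. smooth_on (A \<inter> \<gamma> -` V) (\<psi> \<circ> \<gamma>))"
  by (auto simp: smooth_map_on_def real_line_def inv_id)

text \<open>These degenerate paths represent the identities of \<open>path_category\<close>.\<close>

lemma const_path_in_paths:
  assumes "u \<in> U" "U \<subseteq> topspace (Top B)"
  shows "(a, a, \<lambda>_. u) \<in> paths B U"
  using assms
  by (auto simp: paths_def smooth_map_on_real_line_iff o_def smooth_on_const intro: exI[of _ 1])

text \<open>Left of the junction a local extension of \<open>f\<close> serves, right of it a
  translated local extension of \<open>g\<close>, and at the junction the constant \<open>z\<close>.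
  In the application \<open>f\<close> and \<open>g\<close> are two paths read in one chart, and
  \<open>S\<close>, \<open>T\<close> are the preimages of the chart domain.\<close>

lemma smooth_on_concat:
  fixes f g :: "real \<Rightarrow> 'e::euclidean_space"
  assumes f: "smooth_on ({a..b} \<inter> S) f" and g: "smooth_on ({c..d} \<inter> T) g"
    and \<epsilon>: "\<epsilon> > 0"
    and f_const: "\<And>t. t \<in> {a..b} \<Longrightarrow> b - \<epsilon> < t \<Longrightarrow> f t = z"
    and g_const: "\<And>t. t \<in> {c..d} \<Longrightarrow> t < c + \<epsilon> \<Longrightarrow> g t = z"
    and "a \<le> b" "c \<le> d"
  defines "w \<equiv> \<lambda>t. if t \<le> b then f t else g (t - b + c)"
  shows "smooth_on ({a..b + (d - c)} \<inter> {t. if t \<le> b then t \<in> S else t - b + c \<in> T}) w"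
    (is "smooth_on ?A w")
  unfolding smooth_on_def
proof
  fix x assume x: "x \<in> ?A"
  consider "x < b" | "x = b" | "b < x" by linarith
  then show "\<exists>W k. open W \<and> x \<in> W \<and> (\<forall>n. Ck_on n W k) \<and> (\<forall>y\<in>?A \<inter> W. k y = w y)"
  proof cases
    case 1
    with x have "x \<in> {a..b} \<inter> S" by auto
    with f obtain W k where W: "open W" "x \<in> W" "\<forall>n. Ck_on n W k"
        "\<forall>y\<in>{a..b} \<inter> S \<inter> W. k y = f y"
      unfolding smooth_on_def by meson
    show ?thesis
    proof (intro exI conjI allI ballI)
      \<comment> \<open>The neighbourhood \<open>W\<close> may cross the junction, where
        \<open>w\<close> is no longer \<open>f\<close>; hence the cut at \<open>b\<close>.\<close>
      show "open (W \<inter> {..<b})" "x \<in> W \<inter> {..<b}" using W 1 by auto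
      show "Ck_on n (W \<inter> {..<b}) k" for n using W Ck_on_subset by blast
      show "k y = w y" if "y \<in> ?A \<inter> (W \<inter> {..<b})" for y
        using that W(4) by (auto simp: w_def)
    qed
  next
    case 2
    show ?thesis
    proof (intro exI conjI allI ballI)
      \<comment> \<open>On this interval \<open>w\<close> equals \<open>z\<close> wherever it
        matters: by \<open>f_const\<close> up to \<open>b\<close>, by \<open>g_const\<close>
        beyond.\<close>
      show "open {b - \<epsilon><..<b + \<epsilon>}" "x \<in> {b - \<epsilon><..<b + \<epsilon>}" using 2 \<epsilon> by auto
      show "Ck_on n {b - \<epsilon><..<b + \<epsilon>} (\<lambda>_. z)" for n by (rule Ck_on_const)
      show "z = w y" if "y \<in> ?A \<inter> {b - \<epsilon><..<b + \<epsilon>}" for y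
        using that f_const[of y] g_const[of "y - b + c"] by (auto simp: w_def)
    qed
  next
    case 3
    with x have "x + (c - b) \<in> {c..d} \<inter> T" by (auto simp: algebra_simps)
    with g obtain W k where W: "open W" "x + (c - b) \<in> W" "\<forall>n. Ck_on n W k"
        "\<forall>y\<in>{c..d} \<inter> T \<inter> W. k y = g y"
      unfolding smooth_on_def by meson
    let ?W = "{t. t + (c - b) \<in> W} \<inter> {b<..}"
    show ?thesis
    proof (intro exI conjI allI ballI)
      have "open ((\<lambda>t. t + (c - b)) -` W)"
        using W by (intro open_vimage) (auto intro!: continuous_intros)
      then show "open ?W" by (simp add: vimage_def open_Int)
      show "x \<in> ?W" using W 3 by auto
      show "Ck_on n ?W (\<lambda>t. k (t + (c - b)))" for n
        using W Ck_on_shift Ck_on_subset by (metis inf_le1)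
      show "k (y + (c - b)) = w y" if "y \<in> ?A \<inter> ?W" for y
      proof -
        have "w y = g (y + (c - b))" using that by (simp add: w_def algebra_simps)
        moreover have "y + (c - b) \<in> {c..d} \<inter> T \<inter> W"
          using that by (auto simp: algebra_simps)
        ultimately show ?thesis using W(4) by simp
      qed
    qed
  qed
qed

text \<open>Continuity is the pasting lemma for two closed intervals, and smoothness is
  \<open>smooth_on_concat\<close> in each chart. Constancy near the ends needs care when one of the
  paths is shorter than \<epsilon>.\<close>

lemma concat_path_in_paths:
  assumes p: "p \<in> paths B U" and q: "q \<in> paths B U" and pq: "path_end p = path_start q"
  shows "concat_path q p \<in> paths B U"
proof -
  obtain a b \<gamma> where p_eq: "p = (a, b, \<gamma>)" by (cases p)
  obtain c d \<delta> where q_eq: "q = (c, d, \<delta>)" by (cases q)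
  let ?w = "\<lambda>t. if t \<le> b then \<gamma> t else \<delta> (t - b + c)" and ?b' = "b + (d - c)"
  have ab: "a \<le> b" and cd: "c \<le> d" and join: "\<gamma> b = \<delta> c"
    and im: "\<gamma> ` {a..b} \<subseteq> U" "\<delta> ` {c..d} \<subseteq> U"
    and sm: "smooth_map_on real_line {a..b} B \<gamma>" "smooth_map_on real_line {c..d} B \<delta>"
    using p q pq by (auto simp: p_eq q_eq paths_def)
  obtain \<epsilon>1 where \<epsilon>1: "\<epsilon>1 > 0" "\<And>t. t \<in> {a..b} \<Longrightarrow> t < a + \<epsilon>1 \<Longrightarrow> \<gamma> t = \<gamma> a"
      "\<And>t. t \<in> {a..b} \<Longrightarrow> b - \<epsilon>1 < t \<Longrightarrow> \<gamma> t = \<gamma> b"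
    using p unfolding p_eq paths_def by blast
  obtain \<epsilon>2 where \<epsilon>2: "\<epsilon>2 > 0" "\<And>t. t \<in> {c..d} \<Longrightarrow> t < c + \<epsilon>2 \<Longrightarrow> \<delta> t = \<delta> c"
      "\<And>t. t \<in> {c..d} \<Longrightarrow> d - \<epsilon>2 < t \<Longrightarrow> \<delta> t = \<delta> d"
    using q unfolding q_eq paths_def by blast
  define \<epsilon> where "\<epsilon> = min \<epsilon>1 \<epsilon>2"
  have \<epsilon>: "\<epsilon> > 0" "\<epsilon> \<le> \<epsilon>1" "\<epsilon> \<le> \<epsilon>2" using \<epsilon>1(1) \<epsilon>2(1) by (auto simp: \<epsilon>_def)
  have start: "?w t = ?w a" if "t \<in> {a..?b'}" "t < a + \<epsilon>" for t
  proof (cases "t \<le> b")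
    case True
    then show ?thesis using \<epsilon>1(2)[of t] \<epsilon> that ab by auto
  next
    case False
    \<comment> \<open>The window at \<open>a\<close> reaches beyond \<open>b\<close>, so \<gamma>
      ends at its starting value, and the overhang has length less than \<epsilon> and lies in the
      initial window of \<delta>.\<close>
    then have "\<gamma> b = \<gamma> a" "\<delta> (t - b + c) = \<delta> c"
      using \<epsilon>1(2)[of b] \<epsilon>2(2)[of "t - b + c"] \<epsilon> that ab by auto
    then show ?thesis using False ab join by simp
  qed
  have w_end: "?w ?b' = \<delta> d" using cd join by auto
  have "end": "?w t = ?w ?b'" if "t \<in> {a..?b'}" "?b' - \<epsilon> < t" for t
  proof (cases "t \<le> b")
    case False
    then show ?thesis unfolding w_end using \<epsilon>2(3)[of "t - b + c"] \<epsilon> that cd by auto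
  next
    case True
    \<comment> \<open>The mirror case: the final window covers all of \<delta> and reaches back into
      the final window of \<gamma>.\<close>
    then have "\<gamma> t = \<gamma> b" "\<delta> c = \<delta> d"
      using \<epsilon>1(3)[of t] \<epsilon>2(3)[of c] \<epsilon> that cd by auto
    then show ?thesis unfolding w_end using True join by simp
  qed
  have "continuous_map (top_of_set {a..?b'}) (Top B) ?w"
  proof (rule continuous_map_cases_le)
    have eq1: "{x \<in> topspace (top_of_set {a..?b'}). x \<le> b} = {a..b}"
      using cd by auto
    have eq2: "{x \<in> topspace (top_of_set {a..?b'}). b \<le> x} = {b..?b'}"
      using ab by auto
    show "continuous_map (subtopology (top_of_set {a..?b'}) {x \<in> topspace (top_of_set {a..?b'}). x \<le> b}) (Top B) \<gamma>"
      unfolding eq1 using sm(1) cd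
      by (simp add: smooth_map_on_real_line_iff subtopology_subtopology Int_absorb1)
    have "continuous_map (top_of_set {b..?b'}) (top_of_set {c..d}) (\<lambda>t. t - b + c)"
      by (auto intro!: continuous_intros)
    then have "continuous_map (top_of_set {b..?b'}) (Top B) (\<delta> \<circ> (\<lambda>t. t - b + c))"
      using sm(2) by (intro continuous_map_compose) (auto simp: smooth_map_on_real_line_iff)
    then show "continuous_map (subtopology (top_of_set {a..?b'}) {x \<in> topspace (top_of_set {a..?b'}). b \<le> x}) (Top B) (\<lambda>t. \<delta> (t - b + c))"
      unfolding eq2 using ab
      by (simp add: subtopology_subtopology Int_absorb1 o_def)
  qed (auto simp: join continuous_map_in_subtopology intro!: continuous_intros)
  moreover have "smooth_on ({a..?b'} \<inter> ?w -` V) (\<psi> \<circ> ?w)" if V: "(V, \<psi>) \<in> Atlas B" for V \<psi>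
  proof -
    have "smooth_on ({a..b} \<inter> \<gamma> -` V) (\<psi> \<circ> \<gamma>)" "smooth_on ({c..d} \<inter> \<delta> -` V) (\<psi> \<circ> \<delta>)"
      using sm V by (auto simp: smooth_map_on_real_line_iff)
    then have "smooth_on ({a..?b'} \<inter> {t. if t \<le> b then t \<in> \<gamma> -` V else t - b + c \<in> \<delta> -` V})
        (\<lambda>t. if t \<le> b then (\<psi> \<circ> \<gamma>) t else (\<psi> \<circ> \<delta>) (t - b + c))"
    proof (rule smooth_on_concat[OF _ _ \<epsilon>(1) _ _ ab cd])
      show "(\<psi> \<circ> \<gamma>) t = \<psi> (\<gamma> b)" if "t \<in> {a..b}" "b - \<epsilon> < t" for t
        using \<epsilon>1(3)[of t] that \<epsilon> by simp
      show "(\<psi> \<circ> \<delta>) t = \<psi> (\<gamma> b)" if "t \<in> {c..d}" "t < c + \<epsilon>" for t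
        using \<epsilon>2(2)[of t] that \<epsilon> by (simp add: join)
    qed
    moreover have "(\<lambda>t. if t \<le> b then (\<psi> \<circ> \<gamma>) t else (\<psi> \<circ> \<delta>) (t - b + c)) = \<psi> \<circ> ?w"
      by auto
    moreover have "{t. if t \<le> b then t \<in> \<gamma> -` V else t - b + c \<in> \<delta> -` V} = ?w -` V"
      by auto
    ultimately show ?thesis by simp
  qed
  ultimately have "smooth_map_on real_line {a..?b'} B ?w"
    by (auto simp: smooth_map_on_real_line_iff)
  moreover have "?w ` {a..?b'} \<subseteq> U"
    using im by fastforce
  moreover have "a \<le> ?b'" using ab cd by simp
  ultimately show ?thesis
    unfolding p_eq q_eq concat_path.simps paths_def mem_Collect_eq prod.case
    using \<epsilon>(1) start "end" by (intro conjI exI[of _ \<epsilon>] ballI impI) assumption+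
qed

section \<open>The path category\<close>

text \<open>Projections are used in place of triples so that the rule applies directly to terms such
  as \<open>concat_path q p\<close>.\<close>

lemma translation_relI:
  assumes "p \<in> paths B U" "q \<in> paths B U"
    and "fst q = fst p + s" "fst (snd q) = fst (snd p) + s"
    and "\<And>t. fst p \<le> t \<Longrightarrow> t \<le> fst (snd p) \<Longrightarrow> snd (snd q) (t + s) = snd (snd p) t"
  shows "(p, q) \<in> translation_rel B U"
  using assms by (cases p; cases q) (auto simp: translation_rel_def)

lemma translation_relE:
  assumes "(p, q) \<in> translation_rel B U"
  obtains a b \<gamma> s \<gamma>' where "p = (a, b, \<gamma>)" "q = (a + s, b + s, \<gamma>')" "a \<le> b"
    "p \<in> paths B U" "q \<in> paths B U" "\<And>t. a \<le> t \<Longrightarrow> t \<le> b \<Longrightarrow> \<gamma>' (t + s) = \<gamma> t"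
proof -
  obtain a b \<gamma> where p: "p = (a, b, \<gamma>)" by (cases p)
  obtain a' b' \<gamma>' where q: "q = (a', b', \<gamma>')" by (cases q)
  have pq: "p \<in> paths B U" "q \<in> paths B U"
    using assms by (auto simp: translation_rel_def)
  obtain s where s: "a' = a + s" "b' = b + s" "\<forall>t\<in>{a..b}. \<gamma>' (t + s) = \<gamma> t"
    using assms unfolding p q translation_rel_def by blast
  have "a \<le> b" using pq(1) by (simp add: p paths_def)
  then show thesis
    using that[OF p _ _ pq, of s \<gamma>'] s(3) by (simp add: q s(1,2))
qed

text \<open>The shifts \<open>0\<close>, \<open>- s\<close> and \<open>s + s'\<close> witness
  reflexivity, symmetry and transitivity.\<close>

lemma equiv_translation_rel: "equiv (paths B U) (translation_rel B U)"
proof (rule equivI)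
  show "translation_rel B U \<subseteq> paths B U \<times> paths B U"
    by (auto simp: translation_rel_def)
  show "refl_on (paths B U) (translation_rel B U)"
    by (auto intro!: refl_onI translation_relI[of _ _ _ _ 0])
  show "sym (translation_rel B U)"
  proof (rule symI, elim translation_relE)
    fix p q a b \<gamma> s \<gamma>'
    assume *: "p = (a, b, \<gamma>)" "q = (a + s, b + s, \<gamma>')" "p \<in> paths B U" "q \<in> paths B U"
      "\<And>t. a \<le> t \<Longrightarrow> t \<le> b \<Longrightarrow> \<gamma>' (t + s) = \<gamma> t"
    show "(q, p) \<in> translation_rel B U"
    proof (rule translation_relI[of _ _ _ _ "- s"])
      show "snd (snd p) (t + - s) = snd (snd q) t" if "fst q \<le> t" "t \<le> fst (snd q)" for t
        using *(5)[of "t - s"] that by (simp add: *(1,2))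
    qed (use * in auto)
  qed
  show "trans (translation_rel B U)"
  proof (rule transI, elim translation_relE, clarify)
    fix a b \<gamma> s \<gamma>' s' \<gamma>''
    assume *: "(a, b, \<gamma>) \<in> paths B U" "(a + s + s', b + s + s', \<gamma>'') \<in> paths B U"
      "\<And>t. a \<le> t \<Longrightarrow> t \<le> b \<Longrightarrow> \<gamma>' (t + s) = \<gamma> t"
      "\<And>t. a + s \<le> t \<Longrightarrow> t \<le> b + s \<Longrightarrow> \<gamma>'' (t + s') = \<gamma>' t"
    show "((a, b, \<gamma>), (a + s + s', b + s + s', \<gamma>'')) \<in> translation_rel B U"
    proof (rule translation_relI[of _ _ _ _ "s + s'"])
      fix t assume "fst (a, b, \<gamma>) \<le> t" "t \<le> fst (snd (a, b, \<gamma>))"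
      then show "snd (snd (a + s + s', b + s + s', \<gamma>'')) (t + (s + s')) = snd (snd (a, b, \<gamma>)) t"
        using *(3)[of t] *(4)[of "t + s"] by (simp add: add.assoc)
    qed (use * in auto)
  qed
qed

lemma translation_rel_path_start:
  "(p, q) \<in> translation_rel B U \<Longrightarrow> path_start q = path_start p"
  by (elim translation_relE) simp

lemma translation_rel_path_end:
  "(p, q) \<in> translation_rel B U \<Longrightarrow> path_end q = path_end p"
  by (elim translation_relE) simp

lemma paths_le: "(a, b, \<gamma>) \<in> paths B U \<Longrightarrow> a \<le> b"
  by (simp add: paths_def)

lemma paths_image: "(a, b, \<gamma>) \<in> paths B U \<Longrightarrow> t \<in> {a..b} \<Longrightarrow> \<gamma> t \<in> U"
  unfolding paths_def by blast

lemma path_start_concat: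
  assumes "p \<in> paths B U" shows "path_start (concat_path q p) = path_start p"
  using assms by (cases p; cases q) (auto dest: paths_le)

lemma path_end_concat:
  assumes "q \<in> paths B U" "path_end p = path_start q"
  shows "path_end (concat_path q p) = path_end q"
  using assms by (cases p; cases q) (auto dest: paths_le)

lemma path_start_in: "p \<in> paths B U \<Longrightarrow> path_start p \<in> U"
  by (metis path_start.simps atLeastAtMost_iff order_refl paths_image paths_le prod_cases3)

lemma path_end_in: "p \<in> paths B U \<Longrightarrow> path_end p \<in> U"
  by (metis path_end.simps atLeastAtMost_iff order_refl paths_image paths_le prod_cases3)

text \<open>Concatenation re-anchors the second path at the end of the first, so the shift
  \<open>r\<close> of the second path cancels and the whole concatenation is translated by the shift
  \<open>s\<close> of the first.\<close>

lemma translation_rel_concat: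
  assumes "(p, p') \<in> translation_rel B U" "(q, q') \<in> translation_rel B U"
    and "path_end p = path_start q"
  shows "(concat_path q p, concat_path q' p') \<in> translation_rel B U"
proof -
  have "path_end p' = path_start q'"
    using assms translation_rel_path_start translation_rel_path_end by metis
  then have in_paths: "concat_path q p \<in> paths B U" "concat_path q' p' \<in> paths B U"
    using assms by (auto intro!: concat_path_in_paths simp: translation_rel_def)
  from assms(1) obtain a b \<gamma> s \<gamma>' where p: "p = (a, b, \<gamma>)" "p' = (a + s, b + s, \<gamma>')"
      "\<And>t. a \<le> t \<Longrightarrow> t \<le> b \<Longrightarrow> \<gamma>' (t + s) = \<gamma> t"
    by (elim translation_relE) blast
  from assms(2) obtain c d \<delta> r \<delta>' where q: "q = (c, d, \<delta>)" "q' = (c + r, d + r, \<delta>')"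
      "\<And>t. c \<le> t \<Longrightarrow> t \<le> d \<Longrightarrow> \<delta>' (t + r) = \<delta> t"
    by (elim translation_relE) blast
  show ?thesis
  proof (rule translation_relI[OF in_paths, of s])
    fix t assume t: "fst (concat_path q p) \<le> t" "t \<le> fst (snd (concat_path q p))"
    have "\<delta>' (t + s - (b + s) + (c + r)) = \<delta> (t - b + c)" if "\<not> t \<le> b"
      using q(3)[of "t - b + c"] t that by (simp add: p q algebra_simps)
    then show "snd (snd (concat_path q' p')) (t + s) = snd (snd (concat_path q p)) t"
      using p(3)[of t] t by (simp add: p(1,2) q(1,2))
  qed (simp_all add: p q)
qed

section \<open>Operations on translation classes of paths\<close>

abbreviation path_class :: "('b, 'e::euclidean_space) manifold \<Rightarrow> 'b set \<Rightarrow> 'b path \<Rightarrow> 'b path set"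
  where "path_class B U p \<equiv> translation_rel B U `` {p}"

lemma path_class_self: "p \<in> paths B U \<Longrightarrow> p \<in> path_class B U p"
  using equiv_class_self[OF equiv_translation_rel] .

text \<open>All representatives share their starting point, so the image under
  \<open>path_start\<close> is a singleton and \<open>the_elem\<close> is meaningful.\<close>

lemma class_start_path_class: "p \<in> paths B U \<Longrightarrow> class_start (path_class B U p) = path_start p"
  unfolding class_start_def
  by (rule the_elem_image_unique)
    (use path_class_self in blast, simp add: translation_rel_path_start)

lemma class_end_path_class: "p \<in> paths B U \<Longrightarrow> class_end (path_class B U p) = path_end p"
  unfolding class_end_def
  by (rule the_elem_image_unique)
    (use path_class_self in blast, simp add: translation_rel_path_end)

lemma path_category_MorE:
  assumes "X \<in> Mor (path_category B U)"
  obtains p where "p \<in> paths B U" "X = path_class B U p"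
    "class_start X = path_start p" "class_end X = path_end p"
proof -
  from assms obtain p where "p \<in> paths B U" "X = path_class B U p"
    by (auto simp: path_category_def elim: quotientE)
  then show thesis
    using that class_start_path_class class_end_path_class by metis
qed

lemma path_class_Mor: "p \<in> paths B U \<Longrightarrow> path_class B U p \<in> Mor (path_category B U)"
  by (simp add: path_category_def quotientI)

text \<open>By \<open>translation_rel_concat\<close> all pairs of representatives contribute the
  same class, so the union defining \<open>Comp\<close> collapses to that class; it is a nonempty
  union because a class contains its own representative.\<close>

lemma Comp_path_class:
  assumes "p \<in> paths B U" "q \<in> paths B U" "path_end p = path_start q"
  shows "Comp (path_category B U) (path_class B U q) (path_class B U p) =
    path_class B U (concat_path q p)"
proof -
  have "path_class B U (concat_path q' p') = path_class B U (concat_path q p)"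
    if "p' \<in> path_class B U p" "q' \<in> path_class B U q" for p' q'
    using translation_rel_concat[of p p' B U q q'] assms that
      equiv_class_eq[OF equiv_translation_rel] by blast
  then have "(\<Union>q'\<in>path_class B U q. \<Union>p'\<in>path_class B U p. path_class B U (concat_path q' p'))
      = path_class B U (concat_path q p)"
    using path_class_self[OF assms(1)] path_class_self[OF assms(2)] by blast
  then show ?thesis by (simp add: path_category_def)
qed

text \<open>This is an equality of triples, not only up to translation. The interval of
  \<open>q\<close> having nonnegative length makes the nested case distinctions agree on the whole
  line.\<close>

lemma concat_path_assoc:
  assumes "q \<in> paths B U"
  shows "concat_path r (concat_path q p) = concat_path (concat_path r q) p"
  using assms by (cases p; cases q; cases r) (auto dest!: paths_le simp: algebra_simps fun_eq_iff)

lemma category_path_category: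
  fixes B :: "('b, 'e::euclidean_space) manifold"
  assumes U: "U \<subseteq> topspace (Top B)"
  shows "category (path_category B U)"
proof -
  let ?C = "path_category B U" and ?id = "\<lambda>u. (0, 0, \<lambda>_. u) :: 'b path"
  have id_paths: "?id u \<in> paths B U" if "u \<in> U" for u
    by (rule const_path_in_paths[OF that U])
  have C_simps [simp]: "Obj ?C = U" "Dom ?C = class_start" "Cod ?C = class_end"
    "Id ?C u = path_class B U (?id u)" for u
    by (simp_all add: path_category_def)
  show ?thesis
  proof
    fix X assume "X \<in> Mor ?C"
    then obtain p where p: "p \<in> paths B U" "X = path_class B U p"
        "class_start X = path_start p" "class_end X = path_end p"
      by (rule path_category_MorE)
    obtain a b \<gamma> where p_eq: "p = (a, b, \<gamma>)" by (cases p)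
    show "Dom ?C X \<in> Obj ?C" "Cod ?C X \<in> Obj ?C"
      using p(3,4) path_start_in[OF p(1)] path_end_in[OF p(1)] by simp_all
    note ids = id_paths[OF path_start_in[OF p(1)]] id_paths[OF path_end_in[OF p(1)]]
    have ends: "path_end (?id (path_start p)) = path_start p"
      "path_end p = path_start (?id (path_end p))" by simp_all
    \<comment> \<open>Prepending a path on \<open>[0, 0]\<close> moves \<open>p\<close> to
      \<open>[0, b - a]\<close>; the shift by \<open>a\<close> leads back.\<close>
    have "(concat_path p (?id (path_start p)), p) \<in> translation_rel B U"
      by (rule translation_relI[OF concat_path_in_paths[OF ids(1) p(1)] p(1), of a])
        (auto simp: p_eq)
    from equiv_class_eq[OF equiv_translation_rel this]
    show "Comp ?C X (Id ?C (Dom ?C X)) = X"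
      unfolding C_simps p(3) unfolding p(2) Comp_path_class[OF ids(1) p(1) ends(1)] .
    \<comment> \<open>Appending a degenerate path keeps the parameter interval of \<open>p\<close>,
      hence the shift \<open>0\<close>.\<close>
    have "(concat_path (?id (path_end p)) p, p) \<in> translation_rel B U"
      by (rule translation_relI[OF concat_path_in_paths[OF p(1) ids(2) ends(2)] p(1), of 0])
        (auto simp: p_eq)
    from equiv_class_eq[OF equiv_translation_rel this]
    show "Comp ?C (Id ?C (Cod ?C X)) X = X"
      unfolding C_simps p(4) unfolding p(2) Comp_path_class[OF p(1) ids(2) ends(2)] .
  next
    fix u assume "u \<in> Obj ?C"
    then have u: "?id u \<in> paths B U" using id_paths by simp
    then show "Id ?C u \<in> Mor ?C" "Dom ?C (Id ?C u) = u" "Cod ?C (Id ?C u) = u"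
      using path_class_Mor[OF u] class_start_path_class[OF u] class_end_path_class[OF u]
      by simp_all
  next
    fix X Y assume "X \<in> Mor ?C" "Y \<in> Mor ?C" and XY: "Cod ?C X = Dom ?C Y"
    then obtain p q where p: "p \<in> paths B U" "X = path_class B U p"
        "class_start X = path_start p" "class_end X = path_end p"
      and q: "q \<in> paths B U" "Y = path_class B U q"
        "class_start Y = path_start q" "class_end Y = path_end q"
      by (metis path_category_MorE)
    have pq: "path_end p = path_start q" using XY p q by simp
    have qp: "concat_path q p \<in> paths B U" by (rule concat_path_in_paths[OF p(1) q(1) pq])
    have comp: "Comp ?C Y X = path_class B U (concat_path q p)"
      unfolding p(2) q(2) by (rule Comp_path_class[OF p(1) q(1) pq])
    show "Comp ?C Y X \<in> Mor ?C" unfolding comp by (rule path_class_Mor[OF qp])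
    show "Dom ?C (Comp ?C Y X) = Dom ?C X"
      by (simp add: comp class_start_path_class[OF qp] path_start_concat[OF p(1)] p(3))
    show "Cod ?C (Comp ?C Y X) = Cod ?C Y"
      by (simp add: comp class_end_path_class[OF qp] path_end_concat[OF q(1) pq] q(4))
    fix Z assume "Z \<in> Mor ?C" and YZ: "Cod ?C Y = Dom ?C Z"
    then obtain r where r: "r \<in> paths B U" "Z = path_class B U r"
        "class_start Z = path_start r" "class_end Z = path_end r"
      by (metis path_category_MorE)
    have qr: "path_end q = path_start r" using YZ q r by simp
    have rq: "concat_path r q \<in> paths B U" by (rule concat_path_in_paths[OF q(1) r(1) qr])
    have "Comp ?C Z (Comp ?C Y X) = path_class B U (concat_path r (concat_path q p))"
      unfolding comp r(2)
      by (rule Comp_path_class[OF qp r(1)]) (simp add: path_end_concat[OF q(1) pq] qr)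
    also have "\<dots> = path_class B U (concat_path (concat_path r q) p)"
      by (simp only: concat_path_assoc[OF q(1)])
    also have "\<dots> = Comp ?C (path_class B U (concat_path r q)) X"
      unfolding p(2)
      by (rule Comp_path_class[OF p(1) rq, symmetric]) (simp add: path_start_concat[OF q(1)] pq)
    also have "\<dots> = Comp ?C (Comp ?C Z Y) X"
      unfolding q(2) r(2) by (simp only: Comp_path_class[OF q(1) r(1) qr])
    finally show "Comp ?C Z (Comp ?C Y X) = Comp ?C (Comp ?C Z Y) X" .
  qed
qed

section \<open>Functors into the categorical group\<close>

context crossed_module
begin

lemma tau_closed [simp]: "x \<in> carrier H \<Longrightarrow> \<tau> x \<in> carrier G"
  using tau_hom by (auto simp: hom_def)

lemma tau_mult: "x \<in> carrier H \<Longrightarrow> y \<in> carrier H \<Longrightarrow> \<tau> (x \<otimes>\<^bsub>H\<^esub> y) = \<tau> x \<otimes>\<^bsub>G\<^esub> \<tau> y"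
  using tau_hom by (auto simp: hom_def)

lemma tau_one [simp]: "\<tau> \<one>\<^bsub>H\<^esub> = \<one>\<^bsub>G\<^esub>"
  using hom_one[OF tau_hom H.group_axioms G.group_axioms] .

text \<open>This is the target condition for \<open>theta\<close>, with \<open>x\<close> and
  \<open>y\<close> the values at the two ends of a path.\<close>

lemma tau_mult_inv_mult:
  assumes "x \<in> carrier H" "y \<in> carrier H"
  shows "\<tau> (y \<otimes>\<^bsub>H\<^esub> inv\<^bsub>H\<^esub> x) \<otimes>\<^bsub>G\<^esub> \<tau> x = \<tau> y"
  using assms by (simp add: tau_mult[symmetric] H.m_assoc)

lemma category_categorical_group: "category (categorical_group G H \<alpha> \<tau>)"
  by unfold_locales
    (auto simp: categorical_group_def semidirect_def tau_mult G.m_assoc H.m_assoc)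

text \<open>Composition is preserved because the quotients of end value by start value telescope.
  The map \<open>f\<close> is left general so as to cover both \<open>h i m\<close> and the
  pointwise product of \<open>h i k\<close> and \<open>h k m\<close>.\<close>

lemma is_functor_theta:
  assumes U: "U \<subseteq> topspace (Top B)" and f: "\<And>u. u \<in> U \<Longrightarrow> f u \<in> carrier H"
  shows "is_functor (path_category B U) (categorical_group G H \<alpha> \<tau>) (theta H \<tau> f)"
proof -
  interpret C: category "path_category B U" by (rule category_path_category[OF U])
  interpret D: category "categorical_group G H \<alpha> \<tau>" by (rule category_categorical_group)
  have C_simps: "Obj (path_category B U) = U" "Dom (path_category B U) = class_start"
    "Cod (path_category B U) = class_end"
    by (simp_all add: path_category_def)
  show ?thesis
  proof
    fix u assume u: "u \<in> Obj (path_category B U)"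
    then show "onObj (theta H \<tau> f) u \<in> Obj (categorical_group G H \<alpha> \<tau>)"
      using f by (simp add: C_simps theta_def categorical_group_def)
    show "onMor (theta H \<tau> f) (Id (path_category B U) u) =
        Id (categorical_group G H \<alpha> \<tau>) (onObj (theta H \<tau> f) u)"
      using f u C.Dom_Id[OF u] C.Cod_Id[OF u]
      by (simp add: C_simps theta_def categorical_group_def)
  next
    fix X assume X: "X \<in> Mor (path_category B U)"
    have fX: "f (class_start X) \<in> carrier H" "f (class_end X) \<in> carrier H"
      using C.Dom_Obj[OF X] C.Cod_Obj[OF X] f by (simp_all add: C_simps)
    then show "onMor (theta H \<tau> f) X \<in> Mor (categorical_group G H \<alpha> \<tau>)"
      "Dom (categorical_group G H \<alpha> \<tau>) (onMor (theta H \<tau> f) X) =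
        onObj (theta H \<tau> f) (Dom (path_category B U) X)"
      "Cod (categorical_group G H \<alpha> \<tau>) (onMor (theta H \<tau> f) X) =
        onObj (theta H \<tau> f) (Cod (path_category B U) X)"
      by (simp_all add: C_simps theta_def categorical_group_def semidirect_def tau_mult_inv_mult)
    fix Y assume Y: "Y \<in> Mor (path_category B U)"
      and XY: "Cod (path_category B U) X = Dom (path_category B U) Y"
    have fY: "f (class_end Y) \<in> carrier H"
      using C.Cod_Obj[OF Y] f by (simp add: C_simps)
    \<comment> \<open>The values at the junction cancel; \<open>XY\<close> identifies
      \<open>class_start Y\<close> with \<open>class_end X\<close>.\<close>
    have "(f (class_end Y) \<otimes>\<^bsub>H\<^esub> inv\<^bsub>H\<^esub> f (class_end X)) \<otimes>\<^bsub>H\<^esub>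
        (f (class_end X) \<otimes>\<^bsub>H\<^esub> inv\<^bsub>H\<^esub> f (class_start X)) =
        f (class_end Y) \<otimes>\<^bsub>H\<^esub> inv\<^bsub>H\<^esub> f (class_start X)"
      using fX fY by (simp add: H.m_assoc H.inv_solve_left')
    then show "onMor (theta H \<tau> f) (Comp (path_category B U) Y X) =
        Comp (categorical_group G H \<alpha> \<tau>) (onMor (theta H \<tau> f) Y) (onMor (theta H \<tau> f) X)"
      using XY C.Dom_Comp[OF X Y XY] C.Cod_Comp[OF X Y XY]
      by (simp add: C_simps theta_def categorical_group_def)
  qed
qed

text \<open>The Peiffer identity turns the action of \<open>\<tau> x\<close> into conjugation by
  \<open>x\<close>, and the factor \<open>x\<close> then cancels against its inverse. The left side
  is the \<open>H\<close>-component of a product of two values of \<open>theta\<close>, the right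
  side that of \<open>theta\<close> for the pointwise product.\<close>

lemma mult_alpha_mult_inv:
  assumes "x \<in> carrier H" "x' \<in> carrier H" "y \<in> carrier H" "y' \<in> carrier H"
  shows "(x' \<otimes>\<^bsub>H\<^esub> inv\<^bsub>H\<^esub> x) \<otimes>\<^bsub>H\<^esub> \<alpha> (\<tau> x) (y' \<otimes>\<^bsub>H\<^esub> inv\<^bsub>H\<^esub> y) =
    (x' \<otimes>\<^bsub>H\<^esub> y') \<otimes>\<^bsub>H\<^esub> inv\<^bsub>H\<^esub> (x \<otimes>\<^bsub>H\<^esub> y)"
  using assms by (simp add: alpha_tau H.m_assoc H.inv_mult_group H.inv_solve_left')

end

section \<open>Product functor and natural transformation of a gerbal cocycle\<close>

lemma is_functor_cong:
  assumes "is_functor C D F"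
    and obj: "\<And>x. x \<in> Obj C \<Longrightarrow> onObj F' x = onObj F x"
    and mor: "\<And>f. f \<in> Mor C \<Longrightarrow> onMor F' f = onMor F f"
  shows "is_functor C D F'"
proof -
  interpret is_functor C D F by fact
  show ?thesis
    by unfold_locales
      (simp_all add: obj mor onObj_Obj onMor_Mor onMor_Dom onMor_Cod onMor_Id onMor_Comp
        C.Dom_Obj C.Cod_Obj C.Id_Mor C.Comp_Mor)
qed

text \<open>Continuity into the topological space of the group already confines the values to its
  underlying set.\<close>

lemma smooth_map_on_lie_group_closed:
  assumes "lie_group G" "smooth_map_on M A (mfd G) f" "x \<in> A"
  shows "f x \<in> carrier G"
proof -
  have "f \<in> topspace (subtopology (Top M) A) \<rightarrow> topspace (Top (mfd G))"
    using assms(2) continuous_map_funspace by (fastforce simp: smooth_map_on_def)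
  then show ?thesis
    using assms lie_group.topspace_mfd[OF assms(1)] by (auto simp: smooth_map_on_def)
qed

theorem proposition3p1:
  fixes G :: "('g, 'eg::euclidean_space) lie_group"
    and H :: "('h, 'eh::euclidean_space) lie_group"
    and J :: "('j, 'ej::euclidean_space) lie_group"
    and \<alpha> :: "'g \<Rightarrow> 'h \<Rightarrow> 'h" and \<tau> :: "'h \<Rightarrow> 'g"
    and \<alpha>' :: "'h \<Rightarrow> 'j \<Rightarrow> 'j" and \<tau>' :: "'j \<Rightarrow> 'h"
    and B :: "('b, 'eb::euclidean_space) manifold"
    and I :: "'i set" and U :: "'i \<Rightarrow> 'b set"
    and h :: "'i \<Rightarrow> 'i \<Rightarrow> 'b \<Rightarrow> 'h" and j :: "'i \<Rightarrow> 'i \<Rightarrow> 'i \<Rightarrow> 'b \<Rightarrow> 'j"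
    and i k m :: 'i
  assumes "lie_crossed_module G H \<alpha> \<tau>"
    and "lie_crossed_module H J \<alpha>' \<tau>'"
    and "gerbal_cocycle B I U H J \<alpha>' \<tau>' h j"
    and "i \<in> I" and "k \<in> I" and "m \<in> I"
    and "U i \<inter> U k \<inter> U m \<noteq> {}"
  shows "natural_transformation
           (path_category B (U i \<inter> U k \<inter> U m))
           (categorical_group G H \<alpha> \<tau>)
           (fctr_prod G H \<alpha> (theta H \<tau> (h i k)) (theta H \<tau> (h k m)))
           (theta H \<tau> (h i m))
           (\<lambda>u. (\<tau>' (j i k m u), \<tau> (h i k u) \<otimes>\<^bsub>G\<^esub> \<tau> (h k m u)))"
proof -
  interpret X: lie_crossed_module G H \<alpha> \<tau> by fact
  interpret K: gerbal_cocycle B I U H J \<alpha>' \<tau>' h j by fact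
  let ?U = "U i \<inter> U k \<inter> U m"
  let ?C = "path_category B ?U" and ?D = "categorical_group G H \<alpha> \<tau>"
  let ?f = "\<lambda>u. h i k u \<otimes>\<^bsub>H\<^esub> h k m u"
  have U: "?U \<subseteq> topspace (Top B)"
    using K.open_U[OF \<open>i \<in> I\<close>] openin_subset by blast
  \<comment> \<open>The point \<open>u\<close> itself witnesses the nonempty overlap that
    \<open>smooth_h\<close> asks for.\<close>
  have h_closed: "h p q u \<in> carrier H" if "p \<in> I" "q \<in> I" "u \<in> U p \<inter> U q" for p q u
    using smooth_map_on_lie_group_closed[OF X.H.lie_group_axioms K.smooth_h] that by blast
  have h_in: "h i k u \<in> carrier H" "h k m u \<in> carrier H" "h i m u \<in> carrier H"
    if "u \<in> ?U" for u
    using that h_closed assms(4-6) by auto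
  have j_in: "\<tau>' (j i k m u) \<in> carrier H" if "u \<in> ?U" for u
    using smooth_map_on_lie_group_closed[OF K.H.lie_group_axioms K.smooth_j] that assms(4-7) by simp
  have cocycle: "h i m u = \<tau>' (j i k m u) \<otimes>\<^bsub>H\<^esub> ?f u" if "u \<in> ?U" for u
    using K.cocycle[of i k m u] that assms(4-6) h_in j_in by (simp add: X.H.m_assoc)
  interpret F: is_functor ?C ?D "theta H \<tau> ?f"
    by (rule X.is_functor_theta[OF U]) (simp add: h_in)
  interpret F': is_functor ?C ?D "theta H \<tau> (h i m)"
    by (rule X.is_functor_theta[OF U]) (simp add: h_in)
  have C_simps: "Obj ?C = ?U" "Dom ?C = class_start" "Cod ?C = class_end"
    by (simp_all add: path_category_def)
  have ends: "class_start X \<in> ?U" "class_end X \<in> ?U" if "X \<in> Mor ?C" for X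
    using F.C.Dom_Obj[OF that] F.C.Cod_Obj[OF that] by (simp_all only: C_simps)
  have obj: "onObj (fctr_prod G H \<alpha> (theta H \<tau> (h i k)) (theta H \<tau> (h k m))) u =
      onObj (theta H \<tau> ?f) u" if "u \<in> ?U" for u
    using h_in[OF that] by (simp add: fctr_prod_def theta_def X.tau_mult)
  have mor: "onMor (fctr_prod G H \<alpha> (theta H \<tau> (h i k)) (theta H \<tau> (h k m))) X =
      onMor (theta H \<tau> ?f) X" if "X \<in> Mor ?C" for X
    using h_in[OF ends(1)[OF that]] h_in[OF ends(2)[OF that]]
    by (simp add: fctr_prod_def theta_def semidirect_def X.tau_mult X.mult_alpha_mult_inv)
  \<comment> \<open>Functoriality of the product is transported from
    \<open>theta H \<tau> ?f\<close>, with which it agrees on the objects and morphisms of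
    \<open>?C\<close>.\<close>
  interpret P: is_functor ?C ?D "fctr_prod G H \<alpha> (theta H \<tau> (h i k)) (theta H \<tau> (h k m))"
    by (rule is_functor_cong[OF F.is_functor_axioms]) (use obj mor C_simps in auto)
  show ?thesis
  proof
    fix u assume "u \<in> Obj ?C"
    then have u: "u \<in> ?U" by (simp only: C_simps)
    let ?T = "(\<tau>' (j i k m u), \<tau> (h i k u) \<otimes>\<^bsub>G\<^esub> \<tau> (h k m u))"
    show "?T \<in> Mor ?D"
      using h_in[OF u] j_in[OF u] by (simp add: categorical_group_def semidirect_def)
    show "Dom ?D ?T = onObj (fctr_prod G H \<alpha> (theta H \<tau> (h i k)) (theta H \<tau> (h k m))) u"
      by (simp add: categorical_group_def fctr_prod_def theta_def)
    show "Cod ?D ?T = onObj (theta H \<tau> (h i m)) u"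
      using h_in(1,2)[OF u] j_in[OF u]
      by (simp add: categorical_group_def theta_def cocycle[OF u] X.tau_mult)
  next
    fix X assume X: "X \<in> Mor ?C"
    define u v where "u = class_start X" and "v = class_end X"
    have u: "u \<in> ?U" and v: "v \<in> ?U" using ends[OF X] by (simp_all only: u_def v_def)
    \<comment> \<open>The cocycle identity at the starting point, inverted and solved for the
      inverse of \<open>?f u\<close>.\<close>
    have inv_f: "inv\<^bsub>H\<^esub> ?f u = inv\<^bsub>H\<^esub> h i m u \<otimes>\<^bsub>H\<^esub> \<tau>' (j i k m u)"
      using h_in(1,2)[OF u] j_in[OF u]
      by (simp add: cocycle[OF u] X.H.inv_mult_group X.H.m_assoc)
    \<comment> \<open>Composition keeps the \<open>G\<close>-component of the first morphism, and on
      both sides this is the product of \<open>\<tau> (h i k u)\<close> and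
      \<open>\<tau> (h k m u)\<close>. So naturality is an equation between
      \<open>H\<close>-components, obtained from the cocycle identity at \<open>v\<close> and then
      at \<open>u\<close>.\<close>
    have "\<tau>' (j i k m v) \<otimes>\<^bsub>H\<^esub> (?f v \<otimes>\<^bsub>H\<^esub> inv\<^bsub>H\<^esub> ?f u) =
        h i m v \<otimes>\<^bsub>H\<^esub> inv\<^bsub>H\<^esub> ?f u"
      using h_in(1,2)[OF u] h_in(1,2)[OF v] j_in[OF v]
      by (simp add: cocycle[OF v] X.H.m_assoc)
    also have "\<dots> =
        (h i m v \<otimes>\<^bsub>H\<^esub> inv\<^bsub>H\<^esub> h i m u) \<otimes>\<^bsub>H\<^esub> \<tau>' (j i k m u)"
      using h_in(3)[OF u] h_in(3)[OF v] j_in[OF u] by (simp add: inv_f X.H.m_assoc)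
    finally show "Comp ?D (\<tau>' (j i k m (Cod ?C X)),
          \<tau> (h i k (Cod ?C X)) \<otimes>\<^bsub>G\<^esub> \<tau> (h k m (Cod ?C X)))
        (onMor (fctr_prod G H \<alpha> (theta H \<tau> (h i k)) (theta H \<tau> (h k m))) X) =
      Comp ?D (onMor (theta H \<tau> (h i m)) X)
        (\<tau>' (j i k m (Dom ?C X)),
          \<tau> (h i k (Dom ?C X)) \<otimes>\<^bsub>G\<^esub> \<tau> (h k m (Dom ?C X)))"
      using h_in[OF u] unfolding mor[OF X]
      by (simp add: C_simps categorical_group_def theta_def X.tau_mult
          flip: u_def v_def)
  qed
qed

end
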